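(* For a permutation $\pi=\pi_1\cdots\pi_n$ of $[n]=\{1,\dots,n\}$, call position $i$ a left-to-right minimum if $\pi_i<\pi_j$ for all $j<i$. Given $p\ge1$, let $\pi$ define a play of the following game with players $1,\dots,p$ lined up in this order: for $i=1,2,\dots$, the $i$th throw is made by the player at the front of the line; if $i$ is a left-to-right minimum of $\pi$ the player moves to the back of the line, otherwise the player is eliminated. Say $\pi\in S_n$ encodes a complete $p$-player game won by player $k$ if, when this is carried out for $i=1,\dots,n$, the $n$th throw is the one after which exactly one player remains (equivalently, $\pi$ has exactly $p-1$ positions that are not left-to-right minima and position $n$ is one of them), and the remaining player is $k$. Let $\mathcal W_{n,p,k}$ be the set of such permutations in $S_n$, and for $1\le s\le n$ let $w_{n,p,k,s}$ be the number of $\pi\in\mathcal W_{n,p,k}$ with $\pi_1=s$. Then $w_{n,p,k,s}=0$ whenever $p=1$ or $n=2$, except $w_{2,2,1,1}=1$; and for $n\ge3$, $p\ge2$, $1\le k\le p$, $1\le s\le n$, $$w_{n,p,k,s}=\sum_{s'=1}^{s-1}w_{n-1,p,\overline{k-1},s'}+(n-s)\,w_{n-1,p-1,\hat k,s},$$ where $\overline{k-1}\in[p]$ is the element congruent to $k-1$ modulo $p$, $\hat k=k-1$ for $k\ge3$, $\hat k=1$ for $k=1$, and for $k=2$ the second summand is omitted.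
   Context: Here $n\ge2$ is understood throughout (with $w_{n,p,k,s}$ defined for $n\ge 2$, $p\ge1$, $1\le k\le p$, $1\le s\le n$). *)

theory Defs
  imports Main "HOL-Combinatorics.Permutations" "HOL-Number_Theory.Cong"
begin

definition lr_min :: "(nat \<Rightarrow> nat) \<Rightarrow> nat \<Rightarrow> bool" where
  "lr_min \<pi> i \<longleftrightarrow> (\<forall>j\<in>{1..<i}. \<pi> i < \<pi> j)"

text \<open>The line of players is a list whose head is the front of the line.\<close>

fun throw :: "(nat \<Rightarrow> nat) \<Rightarrow> nat \<Rightarrow> nat list \<Rightarrow> nat list" where
  "throw \<pi> i [] = []"
| "throw \<pi> i (q # qs) = (if lr_min \<pi> i then qs @ [q] else qs)"

fun line_after :: "(nat \<Rightarrow> nat) \<Rightarrow> nat \<Rightarrow> nat \<Rightarrow> nat list" where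
  "line_after \<pi> p 0 = [1..<Suc p]"
| "line_after \<pi> p (Suc i) = throw \<pi> (Suc i) (line_after \<pi> p i)"

text \<open>The game is over after throw \<open>n\<close> and not earlier. The case \<open>i = 0\<close> is included: a game
  with a single player is over before any throw, so that \<open>wins n 1 k\<close> is empty for \<open>n \<ge> 1\<close>.\<close>

definition wins :: "nat \<Rightarrow> nat \<Rightarrow> nat \<Rightarrow> (nat \<Rightarrow> nat) set" where
  "wins n p k = {\<pi>. \<pi> permutes {1..n} \<and> line_after \<pi> p n = [k] \<and>
     (\<forall>i<n. length (line_after \<pi> p i) \<noteq> 1)}"

definition w :: "nat \<Rightarrow> nat \<Rightarrow> nat \<Rightarrow> nat \<Rightarrow> nat" where
  "w n p k s = card {\<pi> \<in> wins n p k. \<pi> 1 = s}"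

definition residue_rep :: "nat \<Rightarrow> nat \<Rightarrow> nat" where
  "residue_rep p m = (THE j. j \<in> {1..p} \<and> [j = m] (mod p))"

definition k_hat :: "nat \<Rightarrow> nat" where
  "k_hat k = (if k \<ge> 3 then k - 1 else 1)"

text \<open>Completeness of the game in terms of the positions that are not left-to-right minima.\<close>

lemma length_line_after:
  "length (line_after \<pi> p i) = p - card {j\<in>{1..i}. \<not> lr_min \<pi> j}"
proof (induction i)
  case (Suc i)
  have eq: "{j\<in>{1..Suc i}. \<not> lr_min \<pi> j} =
      (if lr_min \<pi> (Suc i) then {j\<in>{1..i}. \<not> lr_min \<pi> j}
       else insert (Suc i) {j\<in>{1..i}. \<not> lr_min \<pi> j})"
    by (auto simp: le_Suc_eq)
  show ?case
    using Suc unfolding eq by (cases "line_after \<pi> p i") (auto simp del: One_nat_def)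
qed simp

lemma complete_game_iff:
  assumes "n \<ge> 1" "p \<ge> 1"
  shows "length (line_after \<pi> p n) = 1 \<and> (\<forall>i<n. length (line_after \<pi> p i) \<noteq> 1) \<longleftrightarrow>
    card {j\<in>{1..n}. \<not> lr_min \<pi> j} = p - 1 \<and> \<not> lr_min \<pi> n"
proof -
  obtain m where n: "n = Suc m" using assms(1) by (cases n) auto
  define c where "c i = card {j\<in>{1..i}. \<not> lr_min \<pi> j}" for i
  have eq: "{j\<in>{1..Suc m}. \<not> lr_min \<pi> j} =
      (if lr_min \<pi> (Suc m) then {j\<in>{1..m}. \<not> lr_min \<pi> j}
       else insert (Suc m) {j\<in>{1..m}. \<not> lr_min \<pi> j})"
    by (auto simp: le_Suc_eq)
  have step: "c (Suc m) = (if lr_min \<pi> (Suc m) then c m else Suc (c m))"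
    unfolding c_def eq by auto
  have mono: "c i \<le> c m" if "i \<le> m" for i
    unfolding c_def by (rule card_mono) (use that in auto)
  have len: "length (line_after \<pi> p i) = p - c i" for i
    by (simp add: length_line_after c_def)
  have "p - c n = 1 \<and> (\<forall>i<n. p - c i \<noteq> 1) \<longleftrightarrow> c n = p - 1 \<and> \<not> lr_min \<pi> n"
  proof (cases "lr_min \<pi> n")
    case True
    then have "c n = c m" using step n by simp
    then show ?thesis using True n by auto
  next
    case False
    then have "c n = Suc (c m)" using step n by simp
    moreover have "p - c i \<noteq> 1" if "i < n" "c n = p - 1" for i
      using mono[of i] that n calculation by auto
    ultimately show ?thesis using False assms(2) by auto
  qed
  then show ?thesis unfolding len c_def .
qed

end

theory Submission
  imports Defs
begin

text \<open>
  Position 1 is always a left-to-right minimum, so after the first throw the line is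
  \<open>2, \<dots>, p, 1\<close>. If \<open>\<pi> 2 < \<pi> 1\<close>, deleting the first entry and standardising does not affect which of
  the later positions are left-to-right minima, and leaves a \<open>p\<close>-player game with the players rotated
  by one; the new first entry is \<open>\<pi> 2\<close>, which is any \<open>s' < s\<close>. If \<open>\<pi> 2 > \<pi> 1\<close>, player 2 is eliminated,
  and deleting the second entry and standardising leaves a game of the other \<open>p - 1\<close> players with
  the same first entry; here \<open>\<pi> 2\<close> is any of \<open>n - s\<close> values.
\<close>

section \<open>Inserting and deleting one entry of a permutation\<close>

text \<open>The increasing bijection from the naturals onto the naturals other than
  \<open>a\<close>. It shifts positions as well as values.\<close>

definition skip :: "nat \<Rightarrow> nat \<Rightarrow> nat" where
  "skip a i = (if i < a then i else Suc i)"

text \<open>The left inverse of \<open>skip a\<close>; at \<open>a\<close>, outside the image of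
  \<open>skip a\<close>, the value is a mere default.\<close>

definition unskip :: "nat \<Rightarrow> nat \<Rightarrow> nat" where
  "unskip a i = (if i < a then i else i - 1)"

definition insert_at :: "nat \<Rightarrow> nat \<Rightarrow> (nat \<Rightarrow> nat) \<Rightarrow> nat \<Rightarrow> nat" where
  "insert_at a v \<sigma> i = (if i = a then v else skip v (\<sigma> (unskip a i)))"

definition delete_at :: "nat \<Rightarrow> (nat \<Rightarrow> nat) \<Rightarrow> nat \<Rightarrow> nat" where
  "delete_at a \<pi> i = unskip (\<pi> a) (\<pi> (skip a i))"

lemma skip_neq: "skip a i \<noteq> a"
  by (simp add: skip_def)

lemma skip_eq_iff [simp]: "skip a i = skip a j \<longleftrightarrow> i = j"
  by (auto simp: skip_def)

lemma skip_less_iff [simp]: "skip a i < skip a j \<longleftrightarrow> i < j"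
  by (auto simp: skip_def)

lemma skip_less_self_iff [simp]: "skip a i < a \<longleftrightarrow> i < a"
  by (auto simp: skip_def)

lemma unskip_skip [simp]: "unskip a (skip a i) = i"
  by (simp add: skip_def unskip_def)

lemma skip_unskip: "i \<noteq> a \<Longrightarrow> skip a (unskip a i) = i"
  by (auto simp: skip_def unskip_def)

lemma insert_at_same [simp]: "insert_at a v \<sigma> a = v"
  by (simp add: insert_at_def)

lemma insert_at_skip [simp]: "insert_at a v \<sigma> (skip a i) = skip v (\<sigma> i)"
  by (simp add: insert_at_def skip_neq)

lemma delete_at_insert_at [simp]: "delete_at a (insert_at a v \<sigma>) = \<sigma>"
  by (simp add: delete_at_def fun_eq_iff)

lemma insert_at_delete_at:
  assumes "inj \<pi>"
  shows "insert_at a (\<pi> a) (delete_at a \<pi>) = \<pi>"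
proof
  fix i
  show "insert_at a (\<pi> a) (delete_at a \<pi>) i = \<pi> i"
    by (cases "i = a") (simp_all add: insert_at_def delete_at_def skip_unskip inj_eq[OF assms])
qed

text \<open>If some element of \<open>S\<close> had a value \<open>y\<close> outside
  \<open>S\<close>, it would collide with \<open>y\<close>, which is fixed. So \<open>f\<close> maps
  \<open>S\<close> into itself, and finiteness turns injectivity into bijectivity.\<close>

lemma permutes_if_inj:
  assumes "finite S" "\<And>i. i \<notin> S \<Longrightarrow> f i = i" "inj f"
  shows "f permutes S"
proof (rule bij_imp_permutes)
  have "f ` S \<subseteq> S"
  proof
    fix y assume "y \<in> f ` S"
    then obtain x where x: "x \<in> S" "y = f x" by auto
    show "y \<in> S"
    proof (rule ccontr)
      assume "y \<notin> S"
      with assms(2)[of y] x injD[OF assms(3), of y x] show False by auto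
    qed
  qed
  with assms show "bij_betw f S S"
    by (metis bij_betw_def endo_inj_surj inj_on_subset subset_UNIV)
qed (use assms in auto)

lemma insert_at_permutes:
  assumes "\<sigma> permutes {1..m}" "a \<in> {1..Suc m}" "v \<in> {1..Suc m}"
  shows "insert_at a v \<sigma> permutes {1..Suc m}"
proof (rule permutes_if_inj)
  fix i assume i: "i \<notin> {1..Suc m}"
  \<comment> \<open>Outside \<open>{1..Suc m}\<close> the two shifts cancel: 0 stays put, and a
    larger \<open>i\<close> is lowered to \<open>i - 1 > m\<close>, fixed by
    \<open>\<sigma>\<close>, and raised again by \<open>skip v\<close>.\<close>
  then have "unskip a i \<notin> {1..m}" using assms by (auto simp: unskip_def)
  then have "\<sigma> (unskip a i) = unskip a i" using assms(1) by (simp add: permutes_not_in)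
  then show "insert_at a v \<sigma> i = i"
    using i assms by (auto simp: insert_at_def unskip_def skip_def)
next
  show "inj (insert_at a v \<sigma>)"
  proof (rule injI)
    fix i j assume "insert_at a v \<sigma> i = insert_at a v \<sigma> j"
    then have "i = a \<and> j = a \<or> i \<noteq> a \<and> j \<noteq> a \<and> unskip a i = unskip a j"
      using skip_neq[of v "\<sigma> (unskip a i)"] skip_neq[of v "\<sigma> (unskip a j)"]
        inj_eq[OF permutes_inj[OF assms(1)]]
      by (cases "i = a"; cases "j = a") (simp_all add: insert_at_def)
    then show "i = j" by (metis skip_unskip)
  qed
qed simp

lemma delete_at_permutes:
  assumes "\<pi> permutes {1..Suc m}" "a \<in> {1..Suc m}"
  shows "delete_at a \<pi> permutes {1..m}"
proof (rule permutes_if_inj)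
  have v: "\<pi> a \<in> {1..Suc m}" using assms by (simp only: permutes_in_image)
  fix i assume i: "i \<notin> {1..m}"
  then have "skip a i \<notin> {1..Suc m}" using assms by (auto simp: skip_def)
  then have "\<pi> (skip a i) = skip a i" using assms(1) by (simp add: permutes_not_in)
  then show "delete_at a \<pi> i = i"
    using i assms(2) v by (auto simp: delete_at_def unskip_def skip_def)
next
  show "inj (delete_at a \<pi>)"
  proof (rule injI)
    fix i j assume eq: "delete_at a \<pi> i = delete_at a \<pi> j"
    \<comment> \<open>Injectivity keeps the other values away from \<open>\<pi> a\<close>, the one
      point where \<open>unskip (\<pi> a)\<close> cannot be undone by \<open>skip\<close>.\<close>
    have neq: "\<pi> (skip a l) \<noteq> \<pi> a" for l
      using injD[OF permutes_inj[OF assms(1)]] skip_neq by blast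
    have "\<pi> (skip a i) = \<pi> (skip a j)"
      using eq skip_unskip[OF neq] by (metis delete_at_def)
    then show "i = j"
      using injD[OF permutes_inj[OF assms(1)]] by fastforce
  qed
qed simp

section \<open>Left-to-right minima and the line of players\<close>

lemma lr_min_1 [simp]: "lr_min \<pi> (Suc 0)"
  by (simp add: lr_min_def)

lemma lr_min_less_first: "lr_min \<pi> i \<Longrightarrow> 1 < i \<Longrightarrow> \<pi> i < \<pi> 1"
  by (simp add: lr_min_def)

text \<open>The positions before \<open>Suc i\<close> are \<open>a\<close> and the shifted old ones.
  As \<open>skip v\<close> preserves order, the only new comparison is with \<open>v\<close>. If
  \<open>\<sigma> 1 < v\<close>, it holds at every minimum of \<open>\<sigma>\<close>, since later
  minima lie below \<open>\<sigma> 1\<close>.\<close>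

lemma lr_min_insert_at:
  assumes "1 \<le> a" "a \<le> i"
  shows "lr_min (insert_at a v \<sigma>) (Suc i) \<longleftrightarrow> \<sigma> i < v \<and> lr_min \<sigma> i"
proof -
  have "{1..<Suc i} = insert a (skip a ` {1..<i})"
  proof (intro equalityI subsetI)
    fix j assume "j \<in> {1..<Suc i}"
    then have "j = a \<or> unskip a j \<in> {1..<i} \<and> j = skip a (unskip a j)"
      using assms by (auto simp: skip_def unskip_def)
    then show "j \<in> insert a (skip a ` {1..<i})" by blast
  qed (use assms in \<open>auto simp: skip_def\<close>)
  moreover have "insert_at a v \<sigma> (Suc i) = skip v (\<sigma> i)"
    using insert_at_skip[of a v \<sigma> i] assms by (simp add: skip_def)
  ultimately show ?thesis by (simp add: lr_min_def)
qed

lemma line_after_1: "p \<ge> 1 \<Longrightarrow> line_after \<pi> p (Suc 0) = [2..<Suc p] @ [1]"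
  by (simp add: upt_conv_Cons numeral_2_eq_2 del: upt_Suc)

lemma set_throw_subset: "set (throw \<pi> i qs) \<subseteq> set qs"
  by (cases qs) auto

lemma set_line_after_subset: "set (line_after \<pi> p i) \<subseteq> {1..p}"
proof (induction i)
  case (Suc i)
  then show ?case using set_throw_subset by fastforce
qed auto

text \<open>A line of length one already fixes the number of eliminations at \<open>p - 1\<close>,
  so the clause that the game is not over earlier reduces to an elimination at the last
  throw.\<close>

lemma wins_iff:
  assumes "n \<ge> 1" "p \<ge> 1"
  shows "\<pi> \<in> wins n p k \<longleftrightarrow>
    \<pi> permutes {1..n} \<and> line_after \<pi> p n = [k] \<and> \<not> lr_min \<pi> n"
proof -
  have "card {j\<in>{1..n}. \<not> lr_min \<pi> j} = p - 1" if "line_after \<pi> p n = [k]"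
    using length_line_after[of \<pi> p n] that by simp
  then show ?thesis
    using complete_game_iff[OF assms, of \<pi>] by (auto simp: wins_def)
qed

section \<open>Comparing two games throw by throw\<close>

text \<open>\<open>throw\<close> depends only on places in the line and on whether the position is a
  minimum, so it commutes with a relabelling \<open>f\<close> of the players. The games are offset
  by one throw because \<open>\<pi>\<close> has one entry more.\<close>

lemma line_after_map:
  assumes "line_after \<pi> p (Suc a) = map f (line_after \<sigma> q a)"
    and "\<And>i. i > a \<Longrightarrow> lr_min \<pi> (Suc i) \<longleftrightarrow> lr_min \<sigma> i"
    and "a \<le> i"
  shows "line_after \<pi> p (Suc i) = map f (line_after \<sigma> q i)"
  using assms(3)
proof (induction i rule: dec_induct)
  case (step i)
  then show ?case
    using assms(2)[of "Suc i"] by (cases "line_after \<sigma> q i") (auto simp del: line_after.simps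
      simp: line_after.simps(2)[of \<pi> p "Suc i"] line_after.simps(2)[of \<sigma> q i])
qed (use assms(1) in simp)

text \<open>The common core of both reductions: \<open>a\<close> counts the throws of
  \<open>\<sigma>\<close> made before the games run in parallel. As \<open>a < m\<close>, the last
  throws correspond too. The relabelling has to be invertible only at the winner.\<close>

lemma wins_transfer:
  assumes "line_after \<pi> p (Suc a) = map f (line_after \<sigma> q a)"
    and "\<And>i. i > a \<Longrightarrow> lr_min \<pi> (Suc i) \<longleftrightarrow> lr_min \<sigma> i"
    and "a < m" "1 \<le> p" "1 \<le> q"
    and "\<pi> permutes {1..Suc m}" "\<sigma> permutes {1..m}"
    and "\<And>j. j \<in> {1..q} \<Longrightarrow> f j = k \<longleftrightarrow> j = k'"
  shows "\<pi> \<in> wins (Suc m) p k \<longleftrightarrow> \<sigma> \<in> wins m q k'"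
proof -
  have "line_after \<pi> p (Suc m) = map f (line_after \<sigma> q m)"
    by (rule line_after_map[OF assms(1,2)]) (use assms in auto)
  moreover have "map f (line_after \<sigma> q m) = [k] \<longleftrightarrow> line_after \<sigma> q m = [k']"
    using set_line_after_subset[of \<sigma> q m] assms(8) by (cases "line_after \<sigma> q m") auto
  ultimately show ?thesis
    using assms by (simp add: wins_iff del: line_after.simps)
qed

text \<open>The wraparound: for \<open>k = 1\<close> the residue is 0, and its representative in
  \<open>{1..p}\<close> is \<open>p\<close>.\<close>

lemma residue_rep_pred:
  assumes "1 \<le> k" "k \<le> p"
  shows "residue_rep p (k - 1) = (if k = 1 then p else k - 1)"
  unfolding residue_rep_def
proof (rule the_equality)
  show "(if k = 1 then p else k - 1) \<in> {1..p} \<and> [if k = 1 then p else k - 1 = k - 1] (mod p)"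
    using assms by (auto simp: cong_def)
next
  fix j assume j: "j \<in> {1..p} \<and> [j = k - 1] (mod p)"
  then have "j mod p = k - 1" using assms by (simp add: cong_def)
  then show "j = (if k = 1 then p else k - 1)"
    using j assms by (cases "j = p") auto
qed

text \<open>Transfer with \<open>a = 0\<close>: the line after the first throw is the initial line
  relabelled by the cyclic shift sending \<open>j\<close> to \<open>j + 1\<close> and
  \<open>p\<close> to 1, whose inverse takes \<open>k\<close> to the representative of
  \<open>k - 1\<close>.\<close>

lemma wins_insert_at_1:
  assumes \<sigma>: "\<sigma> permutes {1..m}" and s: "\<sigma> 1 < s" "s \<le> Suc m"
    and k: "1 \<le> k" "k \<le> p" and m: "1 \<le> m"
  shows "insert_at 1 s \<sigma> \<in> wins (Suc m) p k \<longleftrightarrow> \<sigma> \<in> wins m p (residue_rep p (k - 1))"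
proof (rule wins_transfer)
  have "[2..<Suc p] @ [1] = map (\<lambda>j. if j = p then 1 else Suc j) [1..<Suc p]"
    using k by (intro nth_equalityI) (auto simp: nth_append)
  then show "line_after (insert_at 1 s \<sigma>) p (Suc 0) =
      map (\<lambda>j. if j = p then 1 else Suc j) (line_after \<sigma> p 0)"
    using k by (simp only: line_after_1 line_after.simps(1))
next
  \<comment> \<open>For \<open>i = 1\<close> both sides hold because \<open>\<sigma> 1 < s\<close>;
    for larger \<open>i\<close> a minimum of \<open>\<sigma>\<close> is below
    \<open>\<sigma> 1\<close>, hence below \<open>s\<close>.\<close>
  show "lr_min (insert_at 1 s \<sigma>) (Suc i) \<longleftrightarrow> lr_min \<sigma> i" if "0 < i" for i
    using that s lr_min_insert_at[of 1 i s \<sigma>] lr_min_less_first[of \<sigma> i] by (cases "i = 1") auto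
next
  show "insert_at 1 s \<sigma> permutes {1..Suc m}"
    by (rule insert_at_permutes) (use \<sigma> s in auto)
next
  show "(if j = p then 1 else Suc j) = k \<longleftrightarrow> j = residue_rep p (k - 1)" if "j \<in> {1..p}" for j
    unfolding residue_rep_pred[OF k] using that k by auto
qed (use \<sigma> k m in auto)

lemma line_after_insert_at_2:
  assumes "\<sigma> 1 < v" "2 \<le> p"
  shows "line_after (insert_at 2 v \<sigma>) p 2 = [3..<Suc p] @ [1]"
proof -
  have "\<not> lr_min (insert_at 2 v \<sigma>) 2"
    using assms(1) insert_at_skip[of 2 v \<sigma> 1] by (simp add: lr_min_def skip_def) (auto intro: bexI[of _ 1])
  moreover have "line_after (insert_at 2 v \<sigma>) p 2 =
      throw (insert_at 2 v \<sigma>) 2 (line_after (insert_at 2 v \<sigma>) p (Suc 0))"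
    unfolding numeral_2_eq_2 by simp
  moreover have "[2..<Suc p] @ [1] = 2 # [3..<Suc p] @ [1]"
    using assms(2) by (simp add: upt_conv_Cons del: upt_Suc)
  moreover have "line_after (insert_at 2 v \<sigma>) p (Suc 0) = [2..<Suc p] @ [1]"
    by (rule line_after_1) (use assms(2) in simp)
  ultimately show ?thesis by simp
qed

text \<open>Transfer with \<open>a = 1\<close>: the relabelling fixes 1 and raises every other
  player by one, thus jumping over the eliminated player 2. \<open>k_hat\<close> inverts it away
  from 2.\<close>

lemma wins_insert_at_2:
  assumes \<sigma>: "\<sigma> permutes {1..m}" and v: "\<sigma> 1 < v" "v \<le> Suc m"
    and k: "1 \<le> k" "k \<le> p" "k \<noteq> 2" and "2 \<le> p" "2 \<le> m"
  shows "insert_at 2 v \<sigma> \<in> wins (Suc m) p k \<longleftrightarrow> \<sigma> \<in> wins m (p - 1) (k_hat k)"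
proof (rule wins_transfer)
  have "[3..<Suc p] @ [1] = map (\<lambda>j. if j = 1 then 1 else Suc j) ([2..<Suc (p - 1)] @ [1])"
    using assms by (intro nth_equalityI) (auto simp: nth_append)
  moreover have "line_after \<sigma> (p - 1) (Suc 0) = [2..<Suc (p - 1)] @ [1]"
    by (rule line_after_1) (use assms in simp)
  moreover have "line_after (insert_at 2 v \<sigma>) p (Suc 1) = [3..<Suc p] @ [1]"
    using line_after_insert_at_2[of \<sigma> v p] v assms by (simp add: numeral_2_eq_2)
  ultimately show "line_after (insert_at 2 v \<sigma>) p (Suc 1) =
      map (\<lambda>j. if j = 1 then 1 else Suc j) (line_after \<sigma> (p - 1) 1)"
    by (simp only: One_nat_def)
next
  show "lr_min (insert_at 2 v \<sigma>) (Suc i) \<longleftrightarrow> lr_min \<sigma> i" if "1 < i" for i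
    using that v lr_min_insert_at[of 2 i v \<sigma>] lr_min_less_first[of \<sigma> i] by auto
next
  show "insert_at 2 v \<sigma> permutes {1..Suc m}"
    by (rule insert_at_permutes) (use assms in auto)
next
  show "(if j = 1 then 1 else Suc j) = k \<longleftrightarrow> j = k_hat k" if "j \<in> {1..p - 1}" for j
    using that k by (auto simp: k_hat_def)
qed (use assms in auto)

text \<open>Throws never bring a player back, so player 2, gone after the second throw, cannot
  survive.\<close>

lemma two_notin_wins_insert_at_2:
  assumes "\<sigma> 1 < v" "2 \<le> p" "2 \<le> n"
  shows "insert_at 2 v \<sigma> \<notin> wins n p 2"
proof -
  have "2 \<notin> set (line_after (insert_at 2 v \<sigma>) p n)"
    using assms(3)
  proof (induction n rule: dec_induct)
    case base
    show ?case using line_after_insert_at_2[of \<sigma> v p] assms(1,2) by simp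
  next
    case (step n)
    then show ?case using set_throw_subset by fastforce
  qed
  then show ?thesis by (auto simp: wins_def)
qed

section \<open>Counting by the comparison of the first two entries\<close>

lemma wins_permutes: "\<pi> \<in> wins n p k \<Longrightarrow> \<pi> permutes {1..n}"
  by (simp add: wins_def)

lemma finite_wins [simp]: "finite (wins n p k)"
  by (rule finite_subset[OF _ finite_permutations[of "{1..n}"]]) (auto simp: wins_def)

lemma card_wins_descent:
  assumes "1 \<le> m" "1 \<le> k" "k \<le> p" "1 \<le> s" "s \<le> Suc m"
  shows "card {\<pi> \<in> wins (Suc m) p k. \<pi> 1 = s \<and> \<pi> 2 < s} =
    (\<Sum>s'=1..s-1. w m p (residue_rep p (k - 1)) s')"
proof -
  let ?W = "wins m p (residue_rep p (k - 1))"
  \<comment> \<open>The old first entry becomes the second, and \<open>skip s\<close> keeps it on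
    the same side of \<open>s\<close>; thus \<open>\<sigma> 1 < s\<close> matches
    \<open>\<pi> 2 < s\<close>.\<close>
  have 2: "insert_at 1 s \<sigma> 2 = skip s (\<sigma> 1)" for \<sigma>
    using insert_at_skip[of 1 s \<sigma> 1] by (simp add: skip_def numeral_2_eq_2)
  have "bij_betw (insert_at 1 s) {\<sigma> \<in> ?W. \<sigma> 1 < s}
      {\<pi> \<in> wins (Suc m) p k. \<pi> 1 = s \<and> \<pi> 2 < s}"
  proof (rule bij_betw_byWitness[where f' = "delete_at 1"])
    show "\<forall>\<pi>\<in>{\<pi> \<in> wins (Suc m) p k. \<pi> 1 = s \<and> \<pi> 2 < s}. insert_at 1 s (delete_at 1 \<pi>) = \<pi>"
      using insert_at_delete_at wins_permutes permutes_inj by blast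
    show "insert_at 1 s ` {\<sigma> \<in> ?W. \<sigma> 1 < s} \<subseteq> {\<pi> \<in> wins (Suc m) p k. \<pi> 1 = s \<and> \<pi> 2 < s}"
    proof
      fix \<pi> assume "\<pi> \<in> insert_at 1 s ` {\<sigma> \<in> ?W. \<sigma> 1 < s}"
      then obtain \<sigma> where \<sigma>: "\<sigma> \<in> ?W" "\<sigma> 1 < s" "\<pi> = insert_at 1 s \<sigma>" by auto
      then show "\<pi> \<in> {\<pi> \<in> wins (Suc m) p k. \<pi> 1 = s \<and> \<pi> 2 < s}"
        using wins_insert_at_1[OF wins_permutes[OF \<sigma>(1)] \<sigma>(2)] assms
        by (simp add: 2 del: One_nat_def)
    qed
    show "delete_at 1 ` {\<pi> \<in> wins (Suc m) p k. \<pi> 1 = s \<and> \<pi> 2 < s} \<subseteq> {\<sigma> \<in> ?W. \<sigma> 1 < s}"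
    proof
      fix \<sigma> assume "\<sigma> \<in> delete_at 1 ` {\<pi> \<in> wins (Suc m) p k. \<pi> 1 = s \<and> \<pi> 2 < s}"
      then obtain \<pi> where \<pi>: "\<pi> \<in> wins (Suc m) p k" "\<pi> 1 = s" "\<pi> 2 < s" "\<sigma> = delete_at 1 \<pi>"
        by auto
      have eq: "insert_at 1 s \<sigma> = \<pi>"
        using \<pi> insert_at_delete_at[OF permutes_inj[OF wins_permutes[OF \<pi>(1)]], of 1] by simp
      then have lt: "\<sigma> 1 < s" using \<pi>(3) 2[of \<sigma>] by (simp del: One_nat_def)
      have "\<sigma> permutes {1..m}"
        using delete_at_permutes[OF wins_permutes[OF \<pi>(1)], of 1] \<pi>(4) by simp
      then show "\<sigma> \<in> {\<sigma> \<in> ?W. \<sigma> 1 < s}"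
        using wins_insert_at_1[of \<sigma> m s k p] lt eq \<pi>(1) assms by simp
    qed
  qed simp
  then have "card {\<pi> \<in> wins (Suc m) p k. \<pi> 1 = s \<and> \<pi> 2 < s} = card {\<sigma> \<in> ?W. \<sigma> 1 < s}"
    by (simp add: bij_betw_same_card)
  also have "{\<sigma> \<in> ?W. \<sigma> 1 < s} = (\<Union>s'\<in>{1..s-1}. {\<sigma> \<in> ?W. \<sigma> 1 = s'})"
  proof -
    \<comment> \<open>First entries are at least 1, so those below \<open>s\<close> are exactly the
      indices of the sum.\<close>
    have "\<sigma> 1 \<in> {1..m}" if "\<sigma> \<in> ?W" for \<sigma>
      using permutes_in_image[OF wins_permutes[OF that], of 1] assms(1) by simp
    then show ?thesis using assms(4) by fastforce
  qed
  also have "card \<dots> = (\<Sum>s'=1..s-1. w m p (residue_rep p (k - 1)) s')"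
    unfolding w_def by (rule card_UN_disjoint) auto
  finally show ?thesis .
qed

text \<open>The value \<open>v > s\<close> at position 2 is free and does not influence the winner,
  so for \<open>k \<noteq> 2\<close> the set is in bijection with a product, which gives the factor
  \<open>Suc m - s\<close>. The case \<open>k = 2\<close> must be split off because
  \<open>k_hat 2 = 1\<close> is not a preimage of player 2.\<close>

lemma card_wins_ascent:
  assumes "2 \<le> m" "2 \<le> p" "1 \<le> k" "k \<le> p" "1 \<le> s" "s \<le> Suc m"
  shows "card {\<pi> \<in> wins (Suc m) p k. \<pi> 1 = s \<and> s < \<pi> 2} =
    (if k = 2 then 0 else (Suc m - s) * w m (p - 1) (k_hat k) s)"
proof -
  let ?A = "{\<pi> \<in> wins (Suc m) p k. \<pi> 1 = s \<and> s < \<pi> 2}"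
  let ?B = "{\<sigma> \<in> wins m (p - 1) (k_hat k). \<sigma> 1 = s}"
  have 1: "insert_at 2 v \<sigma> 1 = skip v (\<sigma> 1)" for v \<sigma>
    using insert_at_skip[of 2 v \<sigma> 1] by (simp add: skip_def)
  \<comment> \<open>Deleting the second entry lowers only values above \<open>\<pi> 2\<close>, so
    the first entry \<open>s < \<pi> 2\<close> is kept.\<close>
  have A: "insert_at 2 (\<pi> 2) (delete_at 2 \<pi>) = \<pi>" "delete_at 2 \<pi> permutes {1..m}"
    "delete_at 2 \<pi> 1 = s" "\<pi> 2 \<in> {s<..Suc m}" if "\<pi> \<in> ?A" for \<pi>
  proof -
    have perm: "\<pi> permutes {1..Suc m}" using that wins_permutes by blast
    show "insert_at 2 (\<pi> 2) (delete_at 2 \<pi>) = \<pi>"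
      by (rule insert_at_delete_at[OF permutes_inj[OF perm]])
    show "delete_at 2 \<pi> permutes {1..m}"
      by (rule delete_at_permutes[OF perm]) (use assms(1) in simp)
    show "delete_at 2 \<pi> 1 = s" "\<pi> 2 \<in> {s<..Suc m}"
      using that permutes_in_image[OF perm, of 2] assms(1)
      by (auto simp: delete_at_def skip_def unskip_def)
  qed
  show ?thesis
  proof (cases "k = 2")
    case True
    have "?A = {}"
    proof (rule equals0I)
      fix \<pi> assume "\<pi> \<in> ?A"
      with A[OF this] show False
        using two_notin_wins_insert_at_2[of "delete_at 2 \<pi>" "\<pi> 2" p "Suc m"] True assms by auto
    qed
    then show ?thesis using True by (simp only: card.empty if_True simp_thms)
  next
    case False
    have "bij_betw (\<lambda>(v, \<sigma>). insert_at 2 v \<sigma>) ({s<..Suc m} \<times> ?B) ?A"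
    proof (rule bij_betw_byWitness[where f' = "\<lambda>\<pi>. (\<pi> 2, delete_at 2 \<pi>)"])
      show "\<forall>\<pi>\<in>?A. (\<lambda>(v, \<sigma>). insert_at 2 v \<sigma>) (\<pi> 2, delete_at 2 \<pi>) = \<pi>"
        using A(1) by simp
      show "(\<lambda>(v, \<sigma>). insert_at 2 v \<sigma>) ` ({s<..Suc m} \<times> ?B) \<subseteq> ?A"
      proof
        fix \<pi> assume "\<pi> \<in> (\<lambda>(v, \<sigma>). insert_at 2 v \<sigma>) ` ({s<..Suc m} \<times> ?B)"
        then obtain v \<sigma> where \<sigma>: "s < v" "v \<le> Suc m" "\<sigma> \<in> wins m (p - 1) (k_hat k)" "\<sigma> 1 = s"
          "\<pi> = insert_at 2 v \<sigma>" by auto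
        then show "\<pi> \<in> ?A"
          using wins_insert_at_2[OF wins_permutes[OF \<sigma>(3)], of v k p] assms False 1[of v \<sigma>]
          by (simp add: skip_def)
      qed
      show "(\<lambda>\<pi>. (\<pi> 2, delete_at 2 \<pi>)) ` ?A \<subseteq> {s<..Suc m} \<times> ?B"
      proof
        fix x assume "x \<in> (\<lambda>\<pi>. (\<pi> 2, delete_at 2 \<pi>)) ` ?A"
        then obtain \<pi> where \<pi>: "\<pi> \<in> ?A" "x = (\<pi> 2, delete_at 2 \<pi>)" by blast
        then show "x \<in> {s<..Suc m} \<times> ?B"
          using wins_insert_at_2[OF A(2)[OF \<pi>(1)], of "\<pi> 2" k p] A[OF \<pi>(1)] assms False by simp
      qed
    qed auto
    then have "card ?A = card ({s<..Suc m} \<times> ?B)"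
      by (simp only: bij_betw_same_card[symmetric])
    then show ?thesis using False by (simp add: w_def card_cartesian_product)
  qed
qed

lemma w_recurrence:
  assumes "2 \<le> m" "2 \<le> p" "1 \<le> k" "k \<le> p" "1 \<le> s" "s \<le> Suc m"
  shows "w (Suc m) p k s = (\<Sum>s'=1..s-1. w m p (residue_rep p (k - 1)) s') +
    (if k = 2 then 0 else (Suc m - s) * w m (p - 1) (k_hat k) s)"
proof -
  let ?D = "{\<pi> \<in> wins (Suc m) p k. \<pi> 1 = s \<and> \<pi> 2 < s}"
  let ?A = "{\<pi> \<in> wins (Suc m) p k. \<pi> 1 = s \<and> s < \<pi> 2}"
  have "\<pi> 1 \<noteq> \<pi> 2" if "\<pi> \<in> wins (Suc m) p k" for \<pi>
    using injD[OF permutes_inj[OF wins_permutes[OF that]], of 1 2] by auto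
  then have "{\<pi> \<in> wins (Suc m) p k. \<pi> 1 = s} = ?D \<union> ?A"
    by (auto simp: neq_iff)
  moreover have "card (?D \<union> ?A) = card ?D + card ?A"
    by (rule card_Un_disjoint) auto
  ultimately show ?thesis
    using card_wins_descent[of m k p s] card_wins_ascent[of m p k s] assms by (simp add: w_def)
qed

section \<open>Base cases and the assembled statement\<close>

lemma w_one_player: "w n 1 k s = 0" if "n \<ge> 1"
proof -
  have "length (line_after \<pi> 1 0) = 1" for \<pi> by simp
  then have "wins n 1 k = {}" using that by (fastforce simp: wins_def simp del: line_after.simps)
  then show ?thesis by (simp add: w_def)
qed

text \<open>Only the identity of \<open>{1..2}\<close> has a non-minimum at position 2. One
  elimination leaves \<open>p - 1\<close> players, so the game ends exactly for
  \<open>p = 2\<close>, with player 1 remaining.\<close>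

lemma wins_2:
  assumes "p \<ge> 2"
  shows "wins 2 p k = (if p = 2 \<and> k = 1 then {id} else {})"
proof -
  have "\<pi> \<in> wins 2 p k \<longleftrightarrow> p = 2 \<and> k = 1 \<and> \<pi> = id" for \<pi>
  proof -
    have upt: "[2..<Suc p] @ [1] = 2 # [3..<Suc p] @ [1]"
      using assms by (simp add: upt_conv_Cons del: upt_Suc)
    have lr: "\<not> lr_min \<pi> 2 \<longleftrightarrow> \<pi> = id" if "\<pi> permutes {1..2}"
    proof
      assume "\<not> lr_min \<pi> 2"
      then have "\<pi> 1 \<le> \<pi> 2" by (auto simp: lr_min_def not_less le_Suc_eq numeral_2_eq_2)
      moreover have "\<pi> 1 \<in> {1..2}" "\<pi> 2 \<in> {1..2}"
        using permutes_in_image[OF that] by (metis atLeastAtMost_iff one_le_numeral order_refl)+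
      moreover have "\<pi> 1 \<noteq> \<pi> 2"
        using injD[OF permutes_inj[OF that], of 1 2] by auto
      ultimately have "\<pi> 1 = 1" "\<pi> 2 = 2" by auto
      moreover have "\<pi> i = i" if "i \<noteq> 1" "i \<noteq> 2" for i
        using permutes_not_in[OF \<open>\<pi> permutes {1..2}\<close>, of i] that by auto
      ultimately show "\<pi> = id" by (metis eq_id_iff)
    qed (auto simp: lr_min_def)
    have "line_after \<pi> p 2 = throw \<pi> 2 (line_after \<pi> p (Suc 0))"
      unfolding numeral_2_eq_2 by simp
    then have "line_after \<pi> p 2 = [3..<Suc p] @ [1]" if "\<not> lr_min \<pi> 2"
      using that line_after_1[of p \<pi>] assms upt by (simp del: upt_Suc line_after.simps)
    moreover have "[3..<Suc p] @ [1] = [k] \<longleftrightarrow> p = 2 \<and> k = 1"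
      using assms by (cases "p = 2") (auto simp: upt_conv_Cons simp del: upt_Suc)
    ultimately show ?thesis
      using wins_iff[of 2 p \<pi> k] assms lr permutes_id[of "{1..2}"] by auto
  qed
  then show ?thesis by auto
qed

theorem theorem4p8:
  fixes n p k s :: nat
  assumes "n \<ge> 2" and "p \<ge> 1" and "1 \<le> k" and "k \<le> p" and "1 \<le> s" and "s \<le> n"
  shows "(p = 1 \<or> n = 2 \<longrightarrow>
            w n p k s = (if n = 2 \<and> p = 2 \<and> k = 1 \<and> s = 1 then 1 else 0)) \<and>
         (n \<ge> 3 \<and> p \<ge> 2 \<longrightarrow>
            w n p k s = (\<Sum>s'=1..s-1. w (n - 1) p (residue_rep p (k - 1)) s') +
              (if k = 2 then 0 else (n - s) * w (n - 1) (p - 1) (k_hat k) s))"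
proof (intro conjI impI)
  assume "p = 1 \<or> n = 2"
  then show "w n p k s = (if n = 2 \<and> p = 2 \<and> k = 1 \<and> s = 1 then 1 else 0)"
  proof (cases "p = 1")
    case True
    then show ?thesis using w_one_player[of n k s] assms(1) by simp
  next
    case False
    then have "p \<ge> 2" "n = 2" using assms \<open>p = 1 \<or> n = 2\<close> by auto
    moreover have "{\<pi> \<in> {id}. \<pi> 1 = s} = (if s = 1 then {id} else {})" by auto
    ultimately show ?thesis unfolding w_def by (simp only: wins_2) auto
  qed
next
  assume np: "n \<ge> 3 \<and> p \<ge> 2"
  then have n: "Suc (n - 1) = n" "2 \<le> n - 1" by auto
  show "w n p k s = (\<Sum>s'=1..s-1. w (n - 1) p (residue_rep p (k - 1)) s') +
      (if k = 2 then 0 else (n - s) * w (n - 1) (p - 1) (k_hat k) s)"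
    using w_recurrence[of "n - 1" p k s, unfolded n(1)] n(2) np assms by blast
qed

end
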